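(* Consider $N$ agents with dynamics $\dot x_i(t)=u_i(t)$, $x_i(t)\in\mathbb{R}$, and control law $u_i(t)=-\sum_{j\in\mathcal{N}_i^{\mathrm{out}}}w_{ij}(\hat x_i(t)-\hat x_j(t))$, $i\in\{1,\dots,N\}$, executing the event-triggered communication and control law (defined in the context) over a weight-balanced, strongly connected digraph $\mathcal{G}$. Then the agents will not be required to communicate an infinite number of times in any finite time period; that is, in any finite time period each agent broadcasts its state only finitely many times.
   Context: A weighted digraph $\mathcal{G}=(V,E,W)$ has vertices $V=\{1,\dots,N\}$, directed edges $E\subset V\times V$ and weighted adjacency matrix $W=(w_{ij})\in\mathbb{R}_{\ge0}^{N\times N}$ with $w_{ij}>0$ if $(i,j)\in E$ and $w_{ij}=0$ otherwise. If $(i,j)\in E$, $j$ is an out-neighbor of $i$ and $i$ an in-neighbor of $j$; $\mathcal{N}_i^{\mathrm{out}}$ and $\mathcal{N}_i^{\mathrm{in}}$ are the sets of out- and in-neighbors of $i$, and $d_i^{\mathrm{out}}=\sum_{j\in\mathcal{N}_i^{\mathrm{out}}}w_{ij}$. The digraph is weight-balanced if $\sum_{j\in\mathcal{N}_i^{\mathrm{out}}}w_{ij}=\sum_{j\in\mathcal{N}_i^{\mathrm{in}}}w_{ji}$ for every $i$, and strongly connected if there is a directed path from every vertex to every other. Communication: agent $i$ sends information to the agents in $\mathcal{N}_i^{\mathrm{in}}$ and receives information from the agents in $\mathcal{N}_i^{\mathrm{out}}$; broadcasts are received instantaneously. $\hat x_i(t)$ denotes the last broadcast state of agent $i$ at time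 $t\ge0$, so it is constant between consecutive broadcasts of agent $i$ and is reset to the current state $x_i$ when $i$ broadcasts. Each agent has continuous access to its own state. Set $e_i(t)=\hat x_i(t)-x_i(t)$. Design parameters: for each $i$, $\sigma_i\in(0,1)$ and $\varepsilon_i>0$ with $$\varepsilon_i<\sqrt{\frac{\sigma_i}{4d_i^{\mathrm{out}}w_i^{\max}|\mathcal{N}_i^{\mathrm{out}}|}},\qquad w_i^{\max}=\max_{j\in\mathcal{N}_i^{\mathrm{out}}}w_{ij}.$$ Define $$\phi_i=\sum_{j\in\mathcal{N}_i^{\mathrm{out}}}w_{ij}(\hat x_i-\hat x_j)^2,\qquad f_i(e_i)=e_i^2-\frac{\sigma_i}{4d_i^{\mathrm{out}}}\phi_i .$$ Event-triggered communication and control law: at all times $t$, each agent $i$ does the following. (1) If $f_i(e_i(t))>0$, or if $f_i(e_i(t))=0$ and $\phi_i(t)\ne0$, then agent $i$ broadcasts its state $x_i(t)$ and updates its control signal. (2) If agent $i$ receives new information $x_j(t)$ from some neighbor $j\in\mathcal{N}_i^{\mathrm{out}}$, then, letting $t_{\mathrm{last}}^i$ be the last time at which agent $i$ broadcast its state, agent $i$ immediately broadcasts its state $x_i(t)$ if $t\in(t_{\mathrm{last}}^i,t_{\mathrm{last}}^i+\varepsilon_i)$; in any case, it updates its control signal. *)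

theory Defs
  imports "HOL-Analysis.Analysis"
begin

text \<open>
  The agents are the elements of a finite type, which plays the role of $V = \{1,\dots,N\}$.
\<close>

definition weighted_digraph :: "('n::finite \<times> 'n) set \<Rightarrow> ('n \<Rightarrow> 'n \<Rightarrow> real) \<Rightarrow> bool" where
  "weighted_digraph E w \<longleftrightarrow>
     (\<forall>i j. ((i, j) \<in> E \<longrightarrow> w i j > 0) \<and> ((i, j) \<notin> E \<longrightarrow> w i j = 0))"

definition out_nbrs :: "('n::finite \<times> 'n) set \<Rightarrow> 'n \<Rightarrow> 'n set" where
  "out_nbrs E i = {j. (i, j) \<in> E}"

definition in_nbrs :: "('n::finite \<times> 'n) set \<Rightarrow> 'n \<Rightarrow> 'n set" where
  "in_nbrs E i = {j. (j, i) \<in> E}"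

definition out_deg :: "('n::finite \<times> 'n) set \<Rightarrow> ('n \<Rightarrow> 'n \<Rightarrow> real) \<Rightarrow> 'n \<Rightarrow> real" where
  "out_deg E w i = (\<Sum>j\<in>out_nbrs E i. w i j)"

definition weight_balanced :: "('n::finite \<times> 'n) set \<Rightarrow> ('n \<Rightarrow> 'n \<Rightarrow> real) \<Rightarrow> bool" where
  "weight_balanced E w \<longleftrightarrow>
     (\<forall>i. (\<Sum>j\<in>out_nbrs E i. w i j) = (\<Sum>j\<in>in_nbrs E i. w j i))"

definition strongly_connected :: "('n::finite \<times> 'n) set \<Rightarrow> bool" where
  "strongly_connected E \<longleftrightarrow> (\<forall>i j. i \<noteq> j \<longrightarrow> (i, j) \<in> E\<^sup>+)"

definition w_max :: "('n::finite \<times> 'n) set \<Rightarrow> ('n \<Rightarrow> 'n \<Rightarrow> real) \<Rightarrow> 'n \<Rightarrow> real" where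
  "w_max E w i = Max (w i ` out_nbrs E i)"

definition design_parameters ::
  "('n::finite \<times> 'n) set \<Rightarrow> ('n \<Rightarrow> 'n \<Rightarrow> real) \<Rightarrow> ('n \<Rightarrow> real) \<Rightarrow> ('n \<Rightarrow> real) \<Rightarrow> bool" where
  "design_parameters E w \<sigma> \<epsilon> \<longleftrightarrow>
     (\<forall>i. 0 < \<sigma> i \<and> \<sigma> i < 1 \<and> 0 < \<epsilon> i \<and>
          \<epsilon> i < sqrt (\<sigma> i / (4 * out_deg E w i * w_max E w i * real (card (out_nbrs E i)))))"

text \<open>In the next three definitions \<open>xh\<close> is the vector of last broadcast states.\<close>

definition \<phi> :: "('n::finite \<times> 'n) set \<Rightarrow> ('n \<Rightarrow> 'n \<Rightarrow> real) \<Rightarrow> ('n \<Rightarrow> real) \<Rightarrow> 'n \<Rightarrow> real" where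
  "\<phi> E w xh i = (\<Sum>j\<in>out_nbrs E i. w i j * (xh i - xh j)\<^sup>2)"

definition trigger_fun ::
  "('n::finite \<times> 'n) set \<Rightarrow> ('n \<Rightarrow> 'n \<Rightarrow> real) \<Rightarrow> ('n \<Rightarrow> real) \<Rightarrow> ('n \<Rightarrow> real) \<Rightarrow> 'n \<Rightarrow> real \<Rightarrow> real" where
  "trigger_fun E w \<sigma> xh i e = e\<^sup>2 - \<sigma> i / (4 * out_deg E w i) * \<phi> E w xh i"

definition control ::
  "('n::finite \<times> 'n) set \<Rightarrow> ('n \<Rightarrow> 'n \<Rightarrow> real) \<Rightarrow> ('n \<Rightarrow> real) \<Rightarrow> 'n \<Rightarrow> real" where
  "control E w xh i = - (\<Sum>j\<in>out_nbrs E i. w i j * (xh i - xh j))"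

text \<open>
  A candidate run: \<open>traj r i t\<close> is $x_i(t)$ and \<open>bcast r t\<close> is the set of agents that broadcast
  at time \<open>t\<close>.  The last broadcast made before the run starts took place at time
  \<open>time0 r i \<le> 0\<close> and carried the value \<open>hat0 r i\<close>, so that \<open>\<hat>x\<close> makes sense from time 0 on.
\<close>

record 'n run =
  traj :: "'n \<Rightarrow> real \<Rightarrow> real"
  bcast :: "real \<Rightarrow> 'n set"
  hat0 :: "'n \<Rightarrow> real"
  time0 :: "'n \<Rightarrow> real"

definition earlier_bcasts :: "('n::finite) run \<Rightarrow> real \<Rightarrow> 'n \<Rightarrow> real set" where
  "earlier_bcasts r t i = {s. 0 \<le> s \<and> s < t \<and> i \<in> bcast r s}"

text \<open>
  Broadcasts are received instantaneously, so one broadcast at time \<open>t\<close> can cause others at the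
  same \<open>t\<close>.  The next definitions therefore describe the situation at time \<open>t\<close> after exactly the
  agents in \<open>S\<close> have broadcast at \<open>t\<close>: \<open>S = {}\<close> gives the values just before the broadcasts at
  \<open>t\<close>, and \<open>S = bcast r t\<close> the final values at \<open>t\<close>.

  Nothing here presupposes that broadcast times are isolated.  When the set of earlier broadcast
  times has a greatest element, \<open>Sup\<close> is the time of the last broadcast.  When the broadcast times
  of \<open>i\<close> accumulate at \<open>Sup\<close> from the left without attaining it, the value
  \<open>traj r i (Sup \<dots>)\<close> is the limit of the states broadcast.
\<close>

definition last_time :: "('n::finite) run \<Rightarrow> real \<Rightarrow> 'n set \<Rightarrow> 'n \<Rightarrow> real" where
  "last_time r t S i =
     (if i \<in> S then t
      else if earlier_bcasts r t i = {} then time0 r i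
      else Sup (earlier_bcasts r t i))"

definition last_state :: "('n::finite) run \<Rightarrow> real \<Rightarrow> 'n set \<Rightarrow> 'n \<Rightarrow> real" where
  "last_state r t S i =
     (if i \<in> S then traj r i t
      else if earlier_bcasts r t i = {} then hat0 r i
      else traj r i (Sup (earlier_bcasts r t i)))"

definition state_trigger ::
  "('n::finite \<times> 'n) set \<Rightarrow> ('n \<Rightarrow> 'n \<Rightarrow> real) \<Rightarrow> ('n \<Rightarrow> real) \<Rightarrow>
   'n run \<Rightarrow> real \<Rightarrow> 'n set \<Rightarrow> 'n \<Rightarrow> bool" where
  "state_trigger E w \<sigma> r t S i \<longleftrightarrow>
     (let xh = last_state r t S; e = xh i - traj r i t in
        trigger_fun E w \<sigma> xh i e > 0 \<or> (trigger_fun E w \<sigma> xh i e = 0 \<and> \<phi> E w xh i \<noteq> 0))"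

definition reception_trigger ::
  "('n::finite \<times> 'n) set \<Rightarrow> ('n \<Rightarrow> real) \<Rightarrow> 'n run \<Rightarrow> real \<Rightarrow> 'n set \<Rightarrow> 'n \<Rightarrow> bool" where
  "reception_trigger E \<epsilon> r t S i \<longleftrightarrow>
     (\<exists>j\<in>out_nbrs E i. j \<in> S) \<and>
     t \<in> {last_time r t S i <..< last_time r t S i + \<epsilon> i}"

definition must_broadcast ::
  "('n::finite \<times> 'n) set \<Rightarrow> ('n \<Rightarrow> 'n \<Rightarrow> real) \<Rightarrow> ('n \<Rightarrow> real) \<Rightarrow> ('n \<Rightarrow> real) \<Rightarrow>
   'n run \<Rightarrow> real \<Rightarrow> 'n set \<Rightarrow> 'n \<Rightarrow> bool" where
  "must_broadcast E w \<sigma> \<epsilon> r t S i \<longleftrightarrow>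
     state_trigger E w \<sigma> r t S i \<or> reception_trigger E \<epsilon> r t S i"

text \<open>
  The sets of agents that can have broadcast at some stage of the chain of broadcasts at time
  \<open>t\<close>.  Any agents whose conditions hold together may broadcast simultaneously or one after the
  other, so no resolution of ties is singled out.  An agent in \<open>S\<close> has zero error and last
  broadcast time \<open>t\<close>, so neither trigger applies to it again: an agent broadcasts at most once
  at each time, and counting broadcasts amounts to counting broadcast times.
\<close>

inductive cascade ::
  "('n::finite \<times> 'n) set \<Rightarrow> ('n \<Rightarrow> 'n \<Rightarrow> real) \<Rightarrow> ('n \<Rightarrow> real) \<Rightarrow> ('n \<Rightarrow> real) \<Rightarrow>
   'n run \<Rightarrow> real \<Rightarrow> 'n set \<Rightarrow> bool"
  for E w \<sigma> \<epsilon> r t where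
  start: "cascade E w \<sigma> \<epsilon> r t {}"
| step: "cascade E w \<sigma> \<epsilon> r t S \<Longrightarrow> A \<subseteq> {i. must_broadcast E w \<sigma> \<epsilon> r t S i} \<Longrightarrow>
    cascade E w \<sigma> \<epsilon> r t (S \<union> A)"

text \<open>
  Executions on the time interval $[0, T)$ with $0 < T \le \infty$.  A finite horizon is allowed
  so that a run that cannot be continued beyond an accumulation point of broadcasts is not
  excluded.  The control signal jumps at broadcast times, so $\dot x_i = u_i$ is required in
  integrated form.
\<close>

definition execution ::
  "('n::finite \<times> 'n) set \<Rightarrow> ('n \<Rightarrow> 'n \<Rightarrow> real) \<Rightarrow> ('n \<Rightarrow> real) \<Rightarrow> ('n \<Rightarrow> real) \<Rightarrow>
   ereal \<Rightarrow> 'n run \<Rightarrow> bool" where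
  "execution E w \<sigma> \<epsilon> T r \<longleftrightarrow>
     0 < T \<and>
     (\<forall>i. time0 r i \<le> 0 \<and> (time0 r i = 0 \<longrightarrow> hat0 r i = traj r i 0)) \<and>
     (\<forall>t. 0 \<le> t \<and> ereal t < T \<longrightarrow>
        cascade E w \<sigma> \<epsilon> r t (bcast r t) \<and>
        (\<forall>i. \<not> must_broadcast E w \<sigma> \<epsilon> r t (bcast r t) i) \<and>
        (\<forall>i. ((\<lambda>s. control E w (last_state r s (bcast r s)) i)
               has_integral (traj r i t - traj r i 0)) {0..t}))"

end

theory Submission
  imports Defs
begin

text \<open>
  Call an agent an initiator at time \<open>t\<close> if its state trigger holds before anyone has broadcast
  at \<open>t\<close>.  Every time at which somebody broadcasts has an initiator, since receptions alone cannot
  start a cascade.  Suppose \<open>i\<close> is an initiator at \<open>t\<close> and its last broadcast was at \<open>s\<close> with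
  \<open>t - s < \<epsilon> i\<close>.  By the reception rule \<open>i\<close> heard nothing in between, so its control was constant
  there, and Cauchy-Schwarz bounds its squared error by
  $(t-s)^2\, |\mathcal{N}_i^{\mathrm{out}}|\, w_i^{\max} \phi_i$, which the bound on \<open>\<epsilon> i\<close> makes too
  small for the state trigger.  Hence initiations by \<open>i\<close> are at least \<open>\<epsilon> i\<close> apart, and in a bounded
  period there are finitely many initiations, so finitely many times of broadcast by any agent.
\<close>

text \<open>After division by \<open>d\<close>, distinct points are at least 1 apart, so their
  floors are distinct integers in a bounded range.\<close>

lemma finite_separated_reals:
  fixes A :: "real set"
  assumes "0 < d" "A \<subseteq> {a..b}"
    and sep: "\<And>s t. \<lbrakk>s \<in> A; t \<in> A; s < t\<rbrakk> \<Longrightarrow> d \<le> t - s"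
  shows "finite A"
proof -
  have less: "\<lfloor>s / d\<rfloor> < \<lfloor>t / d\<rfloor>" if "s \<in> A" "t \<in> A" "s < t" for s t
  proof -
    have "s / d + 1 \<le> t / d"
      using divide_right_mono[OF sep[OF that], of d] \<open>0 < d\<close> by (simp add: diff_divide_distrib)
    then have "\<lfloor>s / d + 1\<rfloor> \<le> \<lfloor>t / d\<rfloor>"
      by (rule floor_mono)
    then show ?thesis
      by simp
  qed
  have "inj_on (\<lambda>t. \<lfloor>t / d\<rfloor>) A"
    by (rule inj_onI) (metis less less_irrefl linorder_neqE)
  moreover have "(\<lambda>t. \<lfloor>t / d\<rfloor>) ` A \<subseteq> {\<lfloor>a / d\<rfloor>..\<lfloor>b / d\<rfloor>}"
    using assms(1,2) by (fastforce intro: floor_mono divide_right_mono)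
  ultimately show ?thesis
    by (meson finite_atLeastAtMost_int finite_imageD finite_subset)
qed

text \<open>With no out-neighbours, \<open>x / 0 = 0\<close> makes the bound on \<open>\<epsilon> i\<close> read \<open>\<epsilon> i < 0\<close>.\<close>

lemma out_nbrs_nonempty:
  assumes "design_parameters E w \<sigma> \<epsilon>"
  shows "out_nbrs E i \<noteq> {}"
proof
  assume "out_nbrs E i = {}"
  then have "\<epsilon> i < 0" "0 < \<epsilon> i"
    using assms unfolding design_parameters_def by (metis card.empty mult_zero_right
        of_nat_0 div_by_0 real_sqrt_zero)+
  then show False by simp
qed

lemma out_deg_pos:
  assumes "weighted_digraph E w" "out_nbrs E i \<noteq> {}"
  shows "0 < out_deg E w i"
  using assms unfolding out_deg_def
  by (intro sum_pos) (auto simp: weighted_digraph_def out_nbrs_def)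

lemma w_max_ge: "j \<in> out_nbrs E i \<Longrightarrow> w i j \<le> w_max E w i"
  unfolding w_max_def by (intro Max_ge) auto

lemma w_max_pos:
  assumes "weighted_digraph E w" "out_nbrs E i \<noteq> {}"
  shows "0 < w_max E w i"
proof -
  obtain j where j: "j \<in> out_nbrs E i" using assms by auto
  then have "0 < w i j" using assms by (auto simp: weighted_digraph_def out_nbrs_def)
  then show ?thesis using w_max_ge[OF j, of w] by linarith
qed

lemma phi_nonneg: "weighted_digraph E w \<Longrightarrow> 0 \<le> \<phi> E w xh i"
  unfolding \<phi>_def by (intro sum_nonneg mult_nonneg_nonneg)
    (auto simp: weighted_digraph_def out_nbrs_def less_imp_le)

text \<open>Cauchy-Schwarz against the constant 1 gives the cardinality; one factor of each squared
  weight is then bounded by \<open>w_max\<close>, and the other stays as the weight in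
  \<open>\<phi>\<close>.\<close>

lemma control_squared_le:
  assumes "weighted_digraph E w"
  shows "(control E w xh i)\<^sup>2 \<le> real (card (out_nbrs E i)) * w_max E w i * \<phi> E w xh i"
proof -
  let ?N = "out_nbrs E i"
  have "(control E w xh i)\<^sup>2 \<le> (\<Sum>j\<in>?N. (w i j * (xh i - xh j))\<^sup>2) * real (card ?N)"
    unfolding control_def power2_minus by (rule sum_squared_le_sum_of_squares)
  also have "(\<Sum>j\<in>?N. (w i j * (xh i - xh j))\<^sup>2) \<le> (\<Sum>j\<in>?N. w_max E w i * (w i j * (xh i - xh j)\<^sup>2))"
  proof (rule sum_mono)
    fix j assume j: "j \<in> ?N"
    then have "0 < w i j" using assms by (auto simp: weighted_digraph_def out_nbrs_def)
    then show "(w i j * (xh i - xh j))\<^sup>2 \<le> w_max E w i * (w i j * (xh i - xh j)\<^sup>2)"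
      using mult_right_mono[OF w_max_ge[OF j, of w], of "w i j * (xh i - xh j)\<^sup>2"]
      by (simp add: power2_eq_square mult_ac)
  qed
  also have "\<dots> = w_max E w i * \<phi> E w xh i"
    by (simp add: \<phi>_def sum_distrib_left)
  finally show ?thesis
    by (simp add: mult_ac mult_right_mono)
qed

text \<open>A stage that follows the empty set has no sender to react to, so whoever joins there
  does so by the state trigger. Later stages only add agents and keep this one.\<close>

lemma cascade_initiator:
  assumes "cascade E w \<sigma> \<epsilon> r t S" "S \<noteq> {}"
  shows "\<exists>i\<in>S. state_trigger E w \<sigma> r t {} i"
  using assms
proof induction
  case (step S A)
  show ?case
  proof (cases "S = {}")
    case True
    then show ?thesis using step
      by (auto simp: must_broadcast_def reception_trigger_def)
  qed (use step in auto)
qed simp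

lemma earlier_bcasts_eqI:
  assumes "s \<le> t" "\<And>v. \<lbrakk>s \<le> v; v < t\<rbrakk> \<Longrightarrow> i \<notin> bcast r v"
  shows "earlier_bcasts r t i = earlier_bcasts r s i"
  using assms unfolding earlier_bcasts_def by (auto simp: not_le[symmetric])

text \<open>
  The supremum need not be attained: broadcasts of \<open>i\<close> could accumulate at it, even at \<open>t\<close> itself.
  The argument never uses a broadcast at the supremum, only silence after it.
\<close>

lemma initiation_after_last_bcast:
  assumes "weighted_digraph E w" "design_parameters E w \<sigma> \<epsilon>" "execution E w \<sigma> \<epsilon> T r"
    and t: "ereal t < T" and ne: "earlier_bcasts r t i \<noteq> {}"
    and trig: "state_trigger E w \<sigma> r t {} i"
  shows "Sup (earlier_bcasts r t i) + \<epsilon> i \<le> t"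
proof (rule ccontr)
  define s where "s = Sup (earlier_bcasts r t i)"
  define xh where "xh = last_state r t {}"
  let ?N = "out_nbrs E i"
  assume "\<not> ?thesis"
  then have close: "t < s + \<epsilon> i" by (simp add: s_def)
  have bdd: "bdd_above (earlier_bcasts r t i)"
    by (auto simp: earlier_bcasts_def intro!: bdd_aboveI[of _ t] less_imp_le)
  have "s \<le> t"
    unfolding s_def using ne by (intro cSup_least) (auto simp: earlier_bcasts_def)
  have "0 \<le> s"
    unfolding s_def using ne
    by (metis (no_types, lifting) bdd cSup_upper2 earlier_bcasts_def ex_in_conv mem_Collect_eq)
  have silent: "i \<notin> bcast r v" if "s < v" "v < t" for v
    using cSup_upper[OF _ bdd, of v, folded s_def] that \<open>0 \<le> s\<close>
    by (auto simp: earlier_bcasts_def)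
  have same_i: "earlier_bcasts r v i = earlier_bcasts r t i" if "s < v" "v < t" for v
    using earlier_bcasts_eqI[of v t i r] silent that by auto
  have run: "\<not> must_broadcast E w \<sigma> \<epsilon> r v (bcast r v) i"
    "((\<lambda>u. control E w (last_state r u (bcast r u)) i) has_integral
      (traj r i v - traj r i 0)) {0..v}" if "0 \<le> v" "v \<le> t" for v
  proof -
    have "ereal v < T"
      using t that by (meson ereal_less_eq(3) le_less_trans)
    then show "\<not> must_broadcast E w \<sigma> \<epsilon> r v (bcast r v) i"
      "((\<lambda>u. control E w (last_state r u (bcast r u)) i) has_integral
        (traj r i v - traj r i 0)) {0..v}"
      using assms(3) that unfolding execution_def by auto
  qed
  \<comment> \<open>\<open>bcast r v\<close> leaves nobody obliged to broadcast. Hearing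
    \<open>j\<close> less than \<open>\<epsilon> i\<close> after \<open>s\<close> would oblige
    \<open>i\<close>, which is silent at \<open>v\<close>.\<close>
  have quiet: "j \<notin> bcast r v" if "j \<in> ?N" "s < v" "v < t" for j v
  proof
    assume "j \<in> bcast r v"
    moreover have "last_time r v (bcast r v) i = s"
      using silent same_i ne that by (simp add: last_time_def s_def)
    ultimately have "reception_trigger E \<epsilon> r v (bcast r v) i"
      using that close by (auto simp: reception_trigger_def)
    then show False
      using run(1)[of v] that \<open>0 \<le> s\<close> by (simp add: must_broadcast_def)
  qed
  \<comment> \<open>A broadcast by \<open>j\<close> at \<open>s\<close> itself does no harm: it
    precedes both \<open>v\<close> and \<open>t\<close>, so both sides take it into account.\<close>
  have hat: "last_state r v (bcast r v) j = xh j" if "j = i \<or> j \<in> ?N" "s < v" "v < t" for j v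
  proof -
    have no: "j \<notin> bcast r u" if "s < u" "u < t" for u
      using quiet silent \<open>j = i \<or> j \<in> ?N\<close> that by auto
    then have "earlier_bcasts r t j = earlier_bcasts r v j"
      using that by (intro earlier_bcasts_eqI) auto
    then show ?thesis
      using no that by (simp add: xh_def last_state_def)
  qed
  define c where "c = control E w xh i"
  have "((\<lambda>u. control E w (last_state r u (bcast r u)) i) has_integral
      (traj r i t - traj r i s)) {s..t}"
  proof -
    let ?u = "\<lambda>u. control E w (last_state r u (bcast r u)) i"
    have "?u integrable_on {0..t}"
      using run(2)[of t] \<open>0 \<le> s\<close> \<open>s \<le> t\<close> by (auto simp: integrable_on_def)
    then have "?u integrable_on {s..t}"
      by (rule integrable_on_subinterval) (use \<open>0 \<le> s\<close> in auto)
    moreover have "integral {0..s} ?u + integral {s..t} ?u = integral {0..t} ?u"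
      using \<open>0 \<le> s\<close> \<open>s \<le> t\<close> \<open>?u integrable_on {0..t}\<close>
      by (intro Henstock_Kurzweil_Integration.integral_combine) auto
    ultimately show ?thesis
      using run(2)[of t, THEN integral_unique] run(2)[of s, THEN integral_unique]
        \<open>0 \<le> s\<close> \<open>s \<le> t\<close> by (simp add: has_integral_integrable_integral)
  qed
  \<comment> \<open>The endpoints are left out because broadcasts there may change the control; two
    points do not affect the integral.\<close>
  moreover have "((\<lambda>u. control E w (last_state r u (bcast r u)) i) has_integral (t - s) * c) {s..t}"
  proof (rule has_integral_spike_finite)
    show "((\<lambda>_. c) has_integral (t - s) * c) {s..t}"
      using has_integral_const_real[of c s t] \<open>s \<le> t\<close> by simp
    show "control E w (last_state r u (bcast r u)) i = c" if "u \<in> {s..t} - {s, t}" for u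
      using hat[of _ u] that unfolding c_def control_def by auto
  qed simp
  ultimately have "traj r i t - traj r i s = (t - s) * c"
    by (rule has_integral_unique)
  moreover have "xh i = traj r i s"
    using ne by (simp add: xh_def last_state_def s_def)
  ultimately have err: "(xh i - traj r i t)\<^sup>2 = (t - s)\<^sup>2 * c\<^sup>2"
    by (metis minus_diff_eq power2_minus power_mult_distrib)
  let ?k = "real (card ?N) * w_max E w i"
  let ?d = "4 * out_deg E w i"
  have N: "?N \<noteq> {}"
    using assms(2) by (rule out_nbrs_nonempty)
  have pos: "0 < ?d" "0 < ?k"
    using out_deg_pos[OF assms(1) N] w_max_pos[OF assms(1) N] N
    by (auto simp: card_gt_0_iff)
  have eps: "0 < \<epsilon> i" "\<epsilon> i < sqrt (\<sigma> i / (?d * ?k))"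
    using assms(2) by (auto simp: design_parameters_def mult_ac)
  have "(t - s)\<^sup>2 < sqrt (\<sigma> i / (?d * ?k)) ^ 2"
    using close eps \<open>s \<le> t\<close> by (intro power_strict_mono) auto
  also have "\<dots> = \<sigma> i / (?d * ?k)"
    using assms(2) pos by (intro real_sqrt_pow2) (auto simp: design_parameters_def less_imp_le)
  finally have small: "(t - s)\<^sup>2 * ?k < \<sigma> i / ?d"
    using pos by (simp add: field_simps)
  have "(xh i - traj r i t)\<^sup>2 \<le> (t - s)\<^sup>2 * ?k * \<phi> E w xh i"
    unfolding err c_def using control_squared_le[OF assms(1)]
    by (simp add: mult_left_mono mult.assoc)
  \<comment> \<open>If \<open>\<phi>\<close> vanishes, the bound is no longer strict, but then the
    error is zero too, and the trigger with value 0 requires \<open>\<phi>\<close> to be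
    nonzero.\<close>
  moreover have "(t - s)\<^sup>2 * ?k * \<phi> E w xh i < \<sigma> i / ?d * \<phi> E w xh i" if "\<phi> E w xh i \<noteq> 0"
    using small phi_nonneg[OF assms(1), of xh i] that
    by (intro mult_strict_right_mono) auto
  ultimately show False
    using trig by (cases "\<phi> E w xh i = 0")
      (auto simp: state_trigger_def trigger_fun_def Let_def xh_def[symmetric])
qed

theorem proposition5p1:
  fixes E :: "('n::finite \<times> 'n) set"
    and w :: "'n \<Rightarrow> 'n \<Rightarrow> real"
    and \<sigma> \<epsilon> :: "'n \<Rightarrow> real"
    and T :: ereal
    and r :: "'n run"
  assumes "weighted_digraph E w"
    and "weight_balanced E w"
    and "strongly_connected E"
    and "design_parameters E w \<sigma> \<epsilon>"
    and "execution E w \<sigma> \<epsilon> T r"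
  shows "\<forall>i a b. finite {t \<in> {a..b}. 0 \<le> t \<and> ereal t < T \<and> i \<in> bcast r t}"
proof (intro allI)
  fix i :: 'n and a b :: real
  define init where "init k = {t \<in> {a..b}. 0 \<le> t \<and> ereal t < T \<and> k \<in> bcast r t \<and>
    state_trigger E w \<sigma> r t {} k}" for k
  have "finite (init k)" for k
  proof (rule finite_separated_reals)
    show "0 < \<epsilon> k"
      using assms(4) by (simp add: design_parameters_def)
    show "init k \<subseteq> {a..b}"
      by (auto simp: init_def)
    fix s t assume st: "s \<in> init k" "t \<in> init k" "s < t"
    then have s: "s \<in> earlier_bcasts r t k"
      by (simp add: init_def earlier_bcasts_def)
    \<comment> \<open>Other broadcasts of \<open>k\<close>, made on reception, may lie between
      \<open>s\<close> and \<open>t\<close>; they only move the supremum to the right, which keeps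
      the gap at least \<open>\<epsilon> k\<close>.\<close>
    have "s \<le> Sup (earlier_bcasts r t k)"
      by (rule cSup_upper[OF s])
        (auto simp: earlier_bcasts_def intro!: bdd_aboveI[of _ t] less_imp_le)
    moreover have "Sup (earlier_bcasts r t k) + \<epsilon> k \<le> t"
      using initiation_after_last_bcast[OF assms(1,4,5)] st s by (auto simp: init_def)
    ultimately show "\<epsilon> k \<le> t - s" by linarith
  qed
  \<comment> \<open>The initiator of a broadcast time of \<open>i\<close> may be any agent, hence
    the union over all of the finitely many \<open>k\<close>.\<close>
  moreover have "{t \<in> {a..b}. 0 \<le> t \<and> ereal t < T \<and> i \<in> bcast r t} \<subseteq> (\<Union>k. init k)"
  proof
    fix t assume t: "t \<in> {t \<in> {a..b}. 0 \<le> t \<and> ereal t < T \<and> i \<in> bcast r t}"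
    then have "cascade E w \<sigma> \<epsilon> r t (bcast r t)"
      using assms(5) by (simp add: execution_def)
    then show "t \<in> (\<Union>k. init k)"
      using cascade_initiator[of E w \<sigma> \<epsilon> r t "bcast r t"] t by (auto simp: init_def)
  qed
  ultimately show "finite {t \<in> {a..b}. 0 \<le> t \<and> ereal t < T \<and> i \<in> bcast r t}"
    by (meson finite_UN finite finite_subset)
qed

end
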